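(* Let $s>0$. Let $p:\mathbb{R}\to[1,\infty)$ be a measurable function with $1\le p^-\le p^+<\infty$ that is log-Hölder continuous both at the origin (with constant $c_{\log}(p)$) and at infinity (with limit value $p_\infty$). Let $t\mapsto\varepsilon_t$ be a positive measurable function on $(0,\infty)$, and for $t>0$ put $$\eta_t=t^{s}\int_t^\infty \tau^{-s}\varepsilon_\tau\,\frac{d\tau}{\tau},\qquad \lambda_t=t^{-s}\int_0^t\tau^{s}\varepsilon_\tau\,\frac{d\tau}{\tau}.$$ Then there exists a constant $c>0$ depending only on $s$, $p^-$, $c_{\log}(p)$ and $p^+$ such that, with $c$ as the implicit constant in $\approx$ and $\lesssim$, $$\|\eta_t\|_{L^{p(\cdot)}((0,\infty),\frac{dt}{t})}\approx\Big(\int_0^1\eta_t^{p(0)}\frac{dt}{t}\Big)^{\frac1{p(0)}}+\Big(\int_1^\infty\eta_t^{p_\infty}\frac{dt}{t}\Big)^{\frac1{p_\infty}}$$ and $$\|\lambda_t\|_{L^{p(\cdot)}((0,\infty),\frac{dt}{t})}\approx\Big(\int_0^1\lambda_t^{p(0)}\frac{dt}{t}\Big)^{\frac1{p(0)}}+\Big(\int_1^\infty\lambda_t^{p_\infty}\frac{dt}{t}\Big)^{\frac1{p_\infty}}.$$ Moreover, $$\|\eta_t\|_{L^{p(\cdot)}((0,\infty),\frac{dt}{t})}+\|\lambda_t\|_{L^{p(\cdot)}((0,\infty),\frac{dt}{t})}\lesssim\Big(\int_0^1\varepsilon_t^{p(0)}\frac{dt}{t}\Big)^{\frac1{p(0)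}}+\Big(\int_1^\infty\varepsilon_t^{p_\infty}\frac{dt}{t}\Big)^{\frac1{p_\infty}}.$$
   Context: Notation: $p^-=\operatorname{ess\,inf}_{x\in\mathbb{R}}p(x)$ and $p^+=\operatorname{ess\,sup}_{x\in\mathbb{R}}p(x)$. A function $g:\mathbb{R}\to\mathbb{R}$ is log-Hölder continuous at the origin if there is a constant $c_{\log}(g)>0$ such that $|g(x)-g(0)|\le \dfrac{c_{\log}(g)}{\ln(e+1/|x|)}$ for all $x\in\mathbb{R}$ (for $x=0$ this is trivially true). It is log-Hölder continuous at infinity if there are $g_\infty\in\mathbb{R}$ and a constant $c_{\log}>0$ such that $|g(x)-g_\infty|\le\dfrac{c_{\log}}{\ln(e+|x|)}$ for all $x\in\mathbb{R}$. Thus $c_{\log}(p)$ denotes the constant in the condition at the origin for $g=p$, and $p_\infty$ the number $g_\infty$ for $g=p$. For a measurable function $f\ge 0$ on $(0,\infty)$, $\|f\|_{L^{p(\cdot)}((0,\infty),\frac{dt}{t})}$ denotes the Luxemburg norm $\inf\{\mu>0:\int_0^\infty (f(t)/\mu)^{p(t)}\frac{dt}{t}\le 1\}$. $A\lesssim B$ means $A\le cB$ with a constant $c>0$, and $A\approx B$ means $A\lesssim B$ and $B\lesssim A$.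
   Formalization: The constant c may depend also on the log-Hölder constant of p at infinity, not only on s, p^-, c_log(p) at the origin and p^+; without this the claim fails (p=1 on |x|≤R, p=2 on |x|≥2R, linear between, R→∞). *)

theory Defs
  imports "HOL-Analysis.Analysis" "HOL-Probability.Essential_Supremum"
begin

definition ess_inf :: "'a measure \<Rightarrow> ('a \<Rightarrow> ereal) \<Rightarrow> ereal" where
  "ess_inf M f = - esssup M (\<lambda>x. - f x)"

text \<open>At \<open>x = 0\<close> the condition reads \<open>0 \<le> c\<close>, since \<open>1 / 0 = 0\<close>; this agrees with the usual
  convention that the point \<open>x = 0\<close> imposes no constraint.\<close>

definition log_holder_origin :: "real \<Rightarrow> (real \<Rightarrow> real) \<Rightarrow> bool" where
  "log_holder_origin c g \<longleftrightarrow>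
     c > 0 \<and> (\<forall>x. \<bar>g x - g 0\<bar> \<le> c / ln (exp 1 + 1 / \<bar>x\<bar>))"

definition log_holder_infinity :: "real \<Rightarrow> real \<Rightarrow> (real \<Rightarrow> real) \<Rightarrow> bool" where
  "log_holder_infinity c g_inf g \<longleftrightarrow>
     c > 0 \<and> (\<forall>x. \<bar>g x - g_inf\<bar> \<le> c / ln (exp 1 + \<bar>x\<bar>))"

text \<open>Integrals and norms take values in \<open>[0, \<infinity>]\<close>, so that divergent ones have the value
  \<open>\<infinity>\<close>. The power below extends \<open>powr\<close> by \<open>\<infinity>\<close> at \<open>\<infinity>\<close> and is meant for exponents \<open>a > 0\<close>.\<close>

definition ennpowr :: "ennreal \<Rightarrow> real \<Rightarrow> ennreal" where
  "ennpowr x a = (if x = \<infinity> then \<infinity> else ennreal (enn2real x powr a))"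

lemma ennpowr_ennreal [simp]: "0 \<le> x \<Longrightarrow> ennpowr (ennreal x) a = ennreal (x powr a)"
  by (simp add: ennpowr_def)

text \<open>The integral of \<open>f\<close> over \<open>A \<subseteq> (0, \<infinity>)\<close> with respect to \<open>dt / t\<close>.\<close>

definition mult_integral :: "real set \<Rightarrow> (real \<Rightarrow> ennreal) \<Rightarrow> ennreal" where
  "mult_integral A f = (\<integral>\<^sup>+t\<in>A. (f t / ennreal t) \<partial>lebesgue)"

definition luxemburg_norm :: "(real \<Rightarrow> real) \<Rightarrow> (real \<Rightarrow> ennreal) \<Rightarrow> ennreal" where
  "luxemburg_norm p f =
     Inf {ennreal \<mu> | \<mu>. \<mu> > 0 \<and> mult_integral {0<..} (\<lambda>t. ennpowr (f t / ennreal \<mu>) (p t)) \<le> 1}"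

definition split_norm :: "real \<Rightarrow> real \<Rightarrow> (real \<Rightarrow> ennreal) \<Rightarrow> ennreal" where
  "split_norm q r f =
     ennpowr (mult_integral {0<..<1} (\<lambda>t. ennpowr (f t) q)) (1 / q)
     + ennpowr (mult_integral {1<..} (\<lambda>t. ennpowr (f t) r)) (1 / r)"

definition eta :: "real \<Rightarrow> (real \<Rightarrow> real) \<Rightarrow> real \<Rightarrow> ennreal" where
  "eta s \<epsilon> t =
     ennreal (t powr s) * mult_integral {t<..} (\<lambda>\<tau>. ennreal (\<tau> powr (- s) * \<epsilon> \<tau>))"

definition lam :: "real \<Rightarrow> (real \<Rightarrow> real) \<Rightarrow> real \<Rightarrow> ennreal" where
  "lam s \<epsilon> t =
     ennreal (t powr (- s)) * mult_integral {0<..<t} (\<lambda>\<tau>. ennreal (\<tau> powr s * \<epsilon> \<tau>))"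

definition lesssim :: "real \<Rightarrow> ennreal \<Rightarrow> ennreal \<Rightarrow> bool" where
  "lesssim c A B \<longleftrightarrow> A \<le> ennreal c * B"

definition approx_eq :: "real \<Rightarrow> ennreal \<Rightarrow> ennreal \<Rightarrow> bool" where
  "approx_eq c A B \<longleftrightarrow> lesssim c A B \<and> lesssim c B A"

end

theory Submission
  imports Defs
begin

text \<open>
  Write \<open>\<rho>\<^sub>p(f)\<close> for the modular, the integral of \<open>f\<^sup>p\<close> against the Haar measure \<open>dt / t\<close> of
  \<open>(0, \<infinity>)\<close>. By homogeneity, comparing two norms amounts to comparing modulars of \<open>f / \<mu>\<close>
  (\<open>lesssimI\<close>, \<open>lesssim_luxemburg_normI\<close>). The Luxemburg norm belongs to the exponent \<open>p\<close>, and
  the sum of two classical norms to the exponent \<open>q\<close> that is \<open>p(0)\<close> on \<open>(0, 1)\<close> and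
  \<open>p\<^sub>\<infinity>\<close> on \<open>[1, \<infinity>)\<close>.

  \<^emph>\<open>Equivalence of the norms.\<close> The two log-Hoelder conditions say together that
  \<open>\<bar>p(t) - q(t)\<bar> \<le> C / ln (e + 1 / w(t))\<close> with \<open>w(t) = min t (1 / t)\<close>. If \<open>f\<close> is bounded by
  \<open>K \<ge> 1\<close>, then exchanging one exponent for the other in \<open>f\<^sup>p\<close> costs little: where
  \<open>w < f \<le> K\<close>, the factor \<open>f\<^sup>q\<^sup>-\<^sup>p\<close> is at most \<open>K\<^sup>C e\<^sup>C\<close>; where \<open>f \<le> w\<close>, either power is at
  most \<open>w\<close>, which is integrable (\<open>powr_change_exponent\<close>). The boundedness comes from the
  monotonicity built into \<open>\<eta>\<close> and \<open>\<lambda>\<close>: up to the factor \<open>2\<^sup>s\<close>, the value at \<open>t\<close> is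
  dominated by the values on a whole dyadic interval next to \<open>t\<close>. This interval has Haar measure
  \<open>ln 2\<close>, so that a bound for any modular with exponent at least \<open>1\<close> is a pointwise bound
  (\<open>dyadically_dominated_le\<close>). Since nothing here distinguishes \<open>p\<close> from \<open>q\<close>, a single lemma,
  \<open>modular_change_exponent\<close>, yields both inequalities.

  \<^emph>\<open>Hardy's inequality.\<close> \<open>s \<eta>\<close> and \<open>s \<lambda>\<close> are averages of \<open>\<epsilon>\<close> with respect to a kernel and its
  transpose, all of whose rows and columns have mass \<open>1\<close>. For an exponent that is constant along
  the support of the kernel, Jensen's inequality and Tonelli's theorem bound the modular of the
  average by that of the function (\<open>modular_kernel_op_le\<close>). The exponent \<open>q\<close> only jumps at
  \<open>1\<close>, and the part of the kernel that joins \<open>(0, 1)\<close> and \<open>[1, \<infinity>)\<close> is at most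
  \<open>s w(t)\<^sup>s w(\<tau>)\<^sup>s\<close>, a product; it contributes a multiple of \<open>w(t)\<^sup>s\<close> whatever the exponents are
  (\<open>modular_kernel_op_cross\<close>).
\<close>

section \<open>Arithmetic and powers in \<open>[0, \<infinity>]\<close>\<close>

lemma ennreal_cancel_left: "0 < c \<Longrightarrow> ennreal c * x / ennreal c = x"
  by (cases x) (auto simp: ennreal_mult_top ennreal_top_divide divide_ennreal simp flip: ennreal_mult)

lemma ennreal_divide_divide:
  assumes "0 < a" "0 < b"
  shows "x / ennreal a / ennreal b = x / ennreal (a * b)"
  using assms by (cases x) (auto simp: ennreal_top_divide divide_ennreal)

lemma ennpowr_top [simp]: "ennpowr top a = top"
  by (simp add: ennpowr_def)

lemma ennpowr_mono: "x \<le> y \<Longrightarrow> 0 \<le> a \<Longrightarrow> ennpowr x a \<le> ennpowr y a"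
  by (cases x; cases y) (auto intro!: ennreal_leI powr_mono2 simp: top_unique)

lemma ennpowr_divide:
  assumes "0 < \<mu>" "0 < a"
  shows "ennpowr (x / ennreal \<mu>) a = ennpowr x a / ennreal (\<mu> powr a)"
  using assms by (cases x) (auto simp: ennreal_top_divide divide_ennreal powr_divide)

lemma ennpowr_ennpowr: "0 < a \<Longrightarrow> ennpowr (ennpowr x a) b = ennpowr x (a * b)"
  by (cases x) (auto simp: powr_powr)

lemma ennpowr_one [simp]: "ennpowr x 1 = x"
  by (cases x) auto

lemma borel_measurable_ennpowr [measurable (raw)]:
  assumes [measurable]: "f \<in> borel_measurable M" "p \<in> borel_measurable M"
  shows "(\<lambda>x. ennpowr (f x) (p x)) \<in> borel_measurable M"
  unfolding ennpowr_def by measurable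

text \<open>Dividing \<open>x\<close> by \<open>N\<close> gains at least the factor \<open>N\<close>, as the exponent is at least \<open>1\<close>. This
  turns a modular bounded by \<open>N\<close> into one bounded by \<open>1\<close>, as the Luxemburg norm asks for.\<close>

lemma ennpowr_divide_le:
  assumes "1 \<le> N" "1 \<le> a"
  shows "ennpowr (x / ennreal N) a \<le> ennpowr x a / ennreal N"
proof -
  have "N \<le> N powr a"
    using assms powr_mono[of 1 a N] by simp
  with assms show ?thesis
    by (cases x) (auto simp: divide_ennreal ennreal_top_divide powr_divide
        intro!: ennreal_leI divide_left_mono)
qed

lemma le_one_plus_ennpowr: "1 \<le> a \<Longrightarrow> x \<le> 1 + ennpowr x a"
proof (cases x)
  case (real r)
  assume "1 \<le> a"
  have "r \<le> 1 + r powr a"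
  proof (cases "r \<le> 1")
    case False
    then have "r \<le> r powr a"
      using \<open>1 \<le> a\<close> powr_mono[of 1 a r] by simp
    then show ?thesis by simp
  qed (simp add: add_increasing2)
  with real show ?thesis
    by (simp flip: ennreal_plus ennreal_1)
qed simp

text \<open>The way in which estimates of homogeneous quantities are proved below: it suffices to treat
  finite positive upper bounds \<open>\<mu>\<close> of the right-hand side, by which one can divide. The cases in
  which the right-hand side is \<open>0\<close> or \<open>\<infinity>\<close> are dealt with here once and for all.\<close>

lemma lesssimI:
  assumes c: "0 < c" and bound: "\<And>\<mu>. 0 < \<mu> \<Longrightarrow> B \<le> ennreal \<mu> \<Longrightarrow> A \<le> ennreal (c * \<mu>)"
  shows "lesssim c A B"
  unfolding lesssim_def
proof (cases B)
  case (real b)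
  show "A \<le> ennreal c * B"
  proof (rule ennreal_le_epsilon)
    fix e :: real
    assume "0 < e"
    \<comment> \<open>the bound \<open>b + e / c\<close> is positive even if \<open>b = 0\<close>\<close>
    then have "A \<le> ennreal (c * (b + e / c))"
      using c real by (intro bound) (auto intro!: ennreal_leI simp: add_nonneg_pos)
    also have "\<dots> = ennreal c * B + ennreal e"
      using c real \<open>0 < e\<close>
      by (simp add: distrib_left flip: ennreal_mult ennreal_plus)
    finally show "A \<le> ennreal c * B + ennreal e" .
  qed
next
  case top
  then show "A \<le> ennreal c * B"
    using c by (simp add: ennreal_mult_top)
qed

lemma lesssim_trans:
  assumes "lesssim c A B" "lesssim d B C" "0 < c" "0 < d"
  shows "lesssim (c * d) A C"
proof -
  have "A \<le> ennreal c * B"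
    using assms by (simp add: lesssim_def)
  also have "\<dots> \<le> ennreal c * (ennreal d * C)"
    using assms by (intro mult_left_mono) (auto simp: lesssim_def)
  finally show ?thesis
    using assms by (simp add: lesssim_def ennreal_mult mult.assoc)
qed

lemma lesssim_mono:
  assumes "lesssim c A B" "c \<le> d"
  shows "lesssim d A B"
  using assms order_trans[OF _ mult_right_mono[OF ennreal_leI[of c d]]]
  by (auto simp: lesssim_def)

lemma lesssim_add:
  assumes "lesssim c A B" "lesssim c A' B" "0 \<le> c"
  shows "lesssim (2 * c) (A + A') B"
  using add_mono[OF assms(1,2)[unfolded lesssim_def]] assms(3)
  unfolding lesssim_def mult_2[symmetric] by (simp add: ennreal_mult mult.assoc)

section \<open>The Haar measure of the half-line\<close>

text \<open>The measure \<open>dt / t\<close>. Its space is \<open>(0, \<infinity>)\<close> because \<open>\<epsilon>\<close> is measurable there.\<close>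

definition haar :: "real measure" where
  "haar = density (lebesgue_on {0<..}) (\<lambda>t. ennreal (1 / t))"

lemma sigma_finite_lebesgue: "sigma_finite_measure (lebesgue :: real measure)"
proof
  let ?A = "range (\<lambda>n::nat. {- real n .. real n})"
  have "\<Union> ?A = UNIV"
  proof (intro set_eqI iffI)
    fix x :: real
    obtain n :: nat where "\<bar>x\<bar> \<le> real n"
      using real_arch_simple by blast
    then show "x \<in> \<Union> ?A"
      by (auto simp: abs_le_iff intro!: exI[of _ n])
  qed simp
  then show "\<exists>A. countable A \<and> A \<subseteq> sets lebesgue \<and> \<Union> A = space lebesgue
      \<and> (\<forall>a\<in>A. emeasure (lebesgue :: real measure) a \<noteq> \<infinity>)"
    by (intro exI[of _ ?A]) auto
qed

lemma measurable_ident_lebesgue_on [measurable]: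
  "(\<lambda>t. t :: real) \<in> borel_measurable (lebesgue_on S)"
  using id_borel_measurable_lebesgue_on by (simp add: id_def)

lemma measurable_haar_cong [measurable_cong]: "sets haar = sets (lebesgue_on {0<..})"
  by (simp add: haar_def)

lemma space_haar [simp]: "space haar = {0<..}"
  by (simp add: haar_def space_restrict_space)

lemma measurable_ident_haar [measurable]: "(\<lambda>t. t) \<in> borel_measurable haar"
  by measurable

interpretation haar: sigma_finite_measure haar
proof -
  interpret sigma_finite_measure "lebesgue_on {0::real<..}"
    by (rule sigma_finite_measure_restrict_space[OF sigma_finite_lebesgue]) simp
  have "(\<lambda>t. ennreal (1 / t)) \<in> borel_measurable (lebesgue_on {0<..})"
    by measurable
  then show "sigma_finite_measure haar"
    unfolding haar_def by (subst sigma_finite_iff_density_finite) auto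
qed

interpretation haar_pair: pair_sigma_finite haar haar ..

lemma nn_integral_haar:
  assumes [measurable]: "f \<in> borel_measurable haar"
  shows "(\<integral>\<^sup>+t. f t \<partial>haar) = (\<integral>\<^sup>+t. f t / ennreal t * indicator {0<..} t \<partial>lebesgue)"
proof -
  have [measurable]: "(\<lambda>t. ennreal (1 / t)) \<in> borel_measurable (lebesgue_on {0<..})"
    by measurable
  have "f \<in> borel_measurable (lebesgue_on {0<..})"
    using assms by (simp add: haar_def)
  then have "(\<integral>\<^sup>+t. f t \<partial>haar) = (\<integral>\<^sup>+t. ennreal (1 / t) * f t \<partial>lebesgue_on {0<..})"
    unfolding haar_def by (intro nn_integral_density) measurable
  also have "\<dots> = (\<integral>\<^sup>+t. ennreal (1 / t) * f t * indicator {0<..} t \<partial>lebesgue)"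
    by (intro nn_integral_restrict_space) simp
  also have "\<dots> = (\<integral>\<^sup>+t. f t / ennreal t * indicator {0<..} t \<partial>lebesgue)"
    by (intro nn_integral_cong)
       (auto simp: indicator_def divide_ennreal_def inverse_ennreal field_simps)
  finally show ?thesis .
qed

lemma mult_integral_eq_haar:
  assumes [measurable]: "f \<in> borel_measurable haar" and A: "A \<subseteq> {0<..}" "A \<in> sets haar"
  shows "mult_integral A f = (\<integral>\<^sup>+t\<in>A. f t \<partial>haar)"
proof -
  note [measurable] = A(2)
  have "(\<integral>\<^sup>+t\<in>A. f t \<partial>haar)
      = (\<integral>\<^sup>+t. f t * indicator A t / ennreal t * indicator {0<..} t \<partial>lebesgue)"
    by (rule nn_integral_haar) measurable
  also have "\<dots> = mult_integral A f"
    unfolding mult_integral_def using A by (intro nn_integral_cong) (auto simp: indicator_def)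
  finally show ?thesis by simp
qed

lemma nn_integral_haar_real:
  assumes I: "((\<lambda>t. f t / t) has_integral I) A" and A: "A \<subseteq> {0<..}" "A \<in> sets haar"
    and nonneg: "\<And>t. t \<in> A \<Longrightarrow> 0 \<le> f t"
    and [measurable]: "f \<in> borel_measurable haar"
  shows "(\<integral>\<^sup>+t\<in>A. ennreal (f t) \<partial>haar) = ennreal I"
proof -
  note [measurable] = A(2)
  have "(\<integral>\<^sup>+t\<in>A. ennreal (f t) \<partial>haar) = mult_integral A (\<lambda>t. ennreal (f t))"
    using A by (intro mult_integral_eq_haar[symmetric]) auto
  also have "\<dots> = (\<integral>\<^sup>+t. ennreal (f t / t) * indicator A t \<partial>lebesgue)"
    unfolding mult_integral_def using A nonneg
    by (intro nn_integral_cong) (auto simp: indicator_def divide_ennreal subset_eq)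
  also have "\<dots> = (\<integral>\<^sup>+t. ennreal (f t / t) * indicator A t \<partial>lborel)"
    by (simp add: nn_integral_completion)
  also have "\<dots> = ennreal I"
    using A nonneg by (intro nn_integral_has_integral_lebesgue' I) (auto simp: subset_eq less_imp_le)
  finally show ?thesis .
qed

lemma Ioo_in_haar: "0 \<le> a \<Longrightarrow> {a<..<b} \<in> sets haar" "0 \<le> a \<Longrightarrow> {a<..} \<in> sets haar"
  unfolding measurable_haar_cong by (auto simp: sets_restrict_space_iff)

lemma haar_powr_below:
  assumes "0 < s" "0 < b"
  shows "(\<integral>\<^sup>+t\<in>{0<..<b}. ennreal (t powr s) \<partial>haar) = ennreal (b powr s / s)"
proof (rule nn_integral_haar_real)
  have "((\<lambda>t. t powr (s - 1)) has_integral (b powr s / s)) {0..b}"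
    using has_integral_powr_from_0[of "s - 1" b] assms by simp
  then have "((\<lambda>t. t powr (s - 1)) has_integral (b powr s / s)) {0<..<b}"
    by (simp add: has_integral_Icc_iff_Ioo)
  then show "((\<lambda>t. t powr s / t) has_integral (b powr s / s)) {0<..<b}"
    by (rule has_integral_eq[rotated]) (auto simp: powr_diff)
qed (auto simp: Ioo_in_haar)

lemma haar_powr_above:
  assumes "0 < s" "0 < b"
  shows "(\<integral>\<^sup>+t\<in>{b<..}. ennreal (t powr (- s)) \<partial>haar) = ennreal (b powr (- s) / s)"
proof (rule nn_integral_haar_real)
  have "((\<lambda>t. t powr (- s - 1)) has_integral (b powr (- s) / s)) {b..}"
    using has_integral_powr_to_inf[of "- s - 1" b] assms by simp
  then have "((\<lambda>t. t powr (- s - 1)) has_integral (b powr (- s) / s)) {b<..}"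
    by (subst has_integral_spike_set_eq[where T = "{b..}"])
       (rule negligible_subset[of "{b}"]; auto)+
  then show "((\<lambda>t. t powr (- s) / t) has_integral (b powr (- s) / s)) {b<..}"
    using assms by (elim has_integral_eq[rotated]) (auto simp: powr_diff)
qed (use assms in \<open>auto simp: Ioo_in_haar\<close>)

lemma emeasure_haar_dyadic:
  assumes "0 < a"
  shows "emeasure haar {a<..<2 * a} = ennreal (ln 2)"
proof -
  have "((\<lambda>t. 1 / t) has_integral (ln (2 * a) - ln a)) {a..2 * a}"
    using assms by (intro fundamental_theorem_of_calculus)
      (auto intro!: derivative_eq_intros simp: has_real_derivative_iff_has_vector_derivative[symmetric])
  then have "((\<lambda>t. 1 / t) has_integral ln 2) {a<..<2 * a}"
    using assms by (simp add: has_integral_Icc_iff_Ioo ln_mult)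
  then have "(\<integral>\<^sup>+t\<in>{a<..<2 * a}. ennreal 1 \<partial>haar) = ennreal (ln 2)"
    using assms by (intro nn_integral_haar_real) (auto simp: Ioo_in_haar)
  then show ?thesis
    using assms by (simp add: Ioo_in_haar)
qed

lemma AE_haar_neq: "0 < a \<Longrightarrow> AE t in haar. t \<noteq> a"
proof -
  assume a: "0 < a"
  have s: "{a} \<in> sets haar"
    using a unfolding measurable_haar_cong by (auto simp: sets_restrict_space_iff)
  have "(\<integral>\<^sup>+t\<in>{a}. ennreal 1 \<partial>haar) = ennreal 0"
    using a s by (intro nn_integral_haar_real) (auto simp: has_integral_refl)
  then have "{a} \<in> null_sets haar"
    using s by (simp add: null_sets_def)
  then show ?thesis
    by (drule_tac AE_not_in) simp
qed

text \<open>The point \<open>1\<close>, at which the exponents are glued, is a null set.\<close>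

lemma nn_integral_haar_split:
  assumes [measurable]: "f \<in> borel_measurable haar"
  shows "(\<integral>\<^sup>+t. f t \<partial>haar) = (\<integral>\<^sup>+t\<in>{0<..<1}. f t \<partial>haar) + (\<integral>\<^sup>+t\<in>{1<..}. f t \<partial>haar)"
proof -
  have [measurable]: "{0::real<..<1} \<in> sets haar" "{1::real<..} \<in> sets haar"
    by (simp_all add: Ioo_in_haar)
  have "(\<integral>\<^sup>+t. f t \<partial>haar)
      = (\<integral>\<^sup>+t. f t * indicator {0<..<1} t + f t * indicator {1<..} t \<partial>haar)"
  proof (rule nn_integral_cong_AE)
    show "AE t in haar. f t = f t * indicator {0<..<1} t + f t * indicator {1<..} t"
      using AE_haar_neq[OF zero_less_one] AE_space[of haar]
      by eventually_elim (auto simp: indicator_def)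
  qed
  also have "\<dots> = (\<integral>\<^sup>+t\<in>{0<..<1}. f t \<partial>haar) + (\<integral>\<^sup>+t\<in>{1<..}. f t \<partial>haar)"
    by (intro nn_integral_add) measurable
  finally show ?thesis .
qed

text \<open>\<open>weight 1 t\<close> tells how close \<open>t\<close> is to \<open>0\<close> or \<open>\<infinity>\<close>, on the scale on which the log-Hoelder
  conditions are expressed. All powers \<open>weight s\<close> with \<open>s > 0\<close> are bounded by \<open>1\<close> and integrable, which makes
  them the error terms below.\<close>

definition weight :: "real \<Rightarrow> real \<Rightarrow> real" where
  "weight s t = min t (1 / t) powr s"

lemma min_inverse_eq:
  fixes t :: real
  shows "0 < t \<Longrightarrow> t \<le> 1 \<Longrightarrow> min t (1 / t) = t" and "1 \<le> t \<Longrightarrow> min t (1 / t) = 1 / t"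
proof -
  show "min t (1 / t) = t" if "0 < t" "t \<le> 1"
    using that order_trans[of t 1 "1 / t"] by (simp add: min_absorb1)
  show "min t (1 / t) = 1 / t" if "1 \<le> t"
    using that order_trans[of "1 / t" 1 t] by (simp add: min_absorb2)
qed

lemma min_inverse_bounds:
  fixes t :: real
  assumes "0 < t"
  shows "0 < min t (1 / t)" "min t (1 / t) \<le> 1"
  using assms by (cases "t \<le> 1"; simp add: min_inverse_eq)+

lemma weight_bounds: "0 < t \<Longrightarrow> 0 \<le> s \<Longrightarrow> 0 \<le> weight s t \<and> weight s t \<le> 1"
  using min_inverse_bounds[of t] by (simp add: weight_def powr_le1)

lemma measurable_weight [measurable]: "weight s \<in> borel_measurable haar"
  unfolding weight_def[abs_def] by measurable

lemma weight_eq: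
  "0 < t \<Longrightarrow> t \<le> 1 \<Longrightarrow> weight s t = t powr s"
  "1 \<le> t \<Longrightarrow> weight s t = t powr (- s)"
  by (simp_all add: weight_def min_inverse_eq powr_minus powr_divide divide_simps)

lemma nn_integral_weight:
  assumes "0 < s"
  shows "(\<integral>\<^sup>+t. ennreal (weight s t) \<partial>haar) = ennreal (2 / s)"
proof -
  have "(\<integral>\<^sup>+t. ennreal (weight s t) \<partial>haar)
      = (\<integral>\<^sup>+t\<in>{0<..<1}. ennreal (t powr s) \<partial>haar)
        + (\<integral>\<^sup>+t\<in>{1<..}. ennreal (t powr (- s)) \<partial>haar)"
    by (subst nn_integral_haar_split)
       (auto intro!: arg_cong2[where f = "(+)"] nn_integral_cong simp: indicator_def weight_eq)
  also have "\<dots> = ennreal (2 / s)"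
    using assms by (simp add: haar_powr_below haar_powr_above flip: ennreal_plus)
  finally show ?thesis .
qed

section \<open>Changing the exponent\<close>

definition modular :: "(real \<Rightarrow> real) \<Rightarrow> (real \<Rightarrow> ennreal) \<Rightarrow> ennreal" where
  "modular p f = (\<integral>\<^sup>+t. ennpowr (f t) (p t) \<partial>haar)"

text \<open>A one-sided doubling condition without a prescribed side: the dominating values lie to the left
  of \<open>t\<close> for \<open>\<eta>\<close> and to the right for \<open>\<lambda>\<close>.\<close>

definition dyadically_dominated :: "real \<Rightarrow> (real \<Rightarrow> ennreal) \<Rightarrow> bool" where
  "dyadically_dominated K f \<longleftrightarrow>
     (\<forall>t>0. \<exists>a>0. \<forall>u\<in>{a<..<2 * a}. f t \<le> ennreal K * f u)"

text \<open>The value at \<open>t\<close> is at most \<open>K\<close> times the average over a dyadic interval, where \<open>f\<close> is at most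
  \<open>1 + f\<^sup>p\<close>.\<close>

lemma dyadically_dominated_le:
  assumes dom: "dyadically_dominated K f" and mod: "modular p f \<le> ennreal N"
    and p: "\<And>t. 0 < t \<Longrightarrow> 1 \<le> p t" and t: "0 < t" and K: "0 \<le> K" and N: "0 \<le> N"
    and [measurable]: "f \<in> borel_measurable haar" "p \<in> borel_measurable haar"
  shows "f t \<le> ennreal (2 * K * (1 + N))"
proof -
  from dom t obtain a where a: "0 < a" and le: "\<And>u. u \<in> {a<..<2 * a} \<Longrightarrow> f t \<le> ennreal K * f u"
    unfolding dyadically_dominated_def by blast
  have [measurable]: "{a<..<2 * a} \<in> sets haar"
    using a by (simp add: Ioo_in_haar)
  have "f t * ennreal (ln 2) = (\<integral>\<^sup>+u\<in>{a<..<2 * a}. f t \<partial>haar)"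
    using a by (simp add: nn_integral_cmult_indicator emeasure_haar_dyadic)
  also have "\<dots> \<le> (\<integral>\<^sup>+u. ennreal K * (indicator {a<..<2 * a} u + ennpowr (f u) (p u)) \<partial>haar)"
  proof (intro nn_integral_mono)
    fix u assume "u \<in> space haar"
    then have "f u \<le> 1 + ennpowr (f u) (p u)"
      by (intro le_one_plus_ennpowr p) simp
    then have "f t \<le> ennreal K * (1 + ennpowr (f u) (p u))" if "u \<in> {a<..<2 * a}"
      by (rule order_trans[OF le[OF that] mult_left_mono]) auto
    then show "f t * indicator {a<..<2 * a} u
        \<le> ennreal K * (indicator {a<..<2 * a} u + ennpowr (f u) (p u))"
      by (auto simp: indicator_def)
  qed
  also have "\<dots> = ennreal K * (emeasure haar {a<..<2 * a} + modular p f)"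
    by (simp add: nn_integral_cmult nn_integral_add modular_def)
  also have "\<dots> \<le> ennreal K * (ennreal 1 + ennreal N)"
    using a mod ln_2_less_1 by (intro mult_left_mono add_mono) (auto simp: emeasure_haar_dyadic)
  finally have *: "f t * ennreal (ln 2) \<le> ennreal (K * (1 + N))"
    using K N by (simp add: ennreal_mult)
  show ?thesis
  proof (cases "f t")
    case (real r)
    then have "r * ln 2 \<le> K * (1 + N)"
      using * K N by (simp flip: ennreal_mult)
    moreover have "r * (1 / 2) \<le> r * ln 2"
      using real ln2_ge_two_thirds by (intro mult_left_mono) auto
    ultimately show ?thesis
      using real by (auto intro!: ennreal_leI)
  next
    case top
    then show ?thesis
      using * by (simp add: ennreal_top_mult top_unique)
  qed
qed

text \<open>The logarithmic modulus of continuity is exactly what bounds \<open>x\<^sup>b\<^sup>-\<^sup>a\<close> for \<open>w < x < 1\<close>: it is at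
  most \<open>w\<close> to the power \<open>- \<bar>a - b\<bar>\<close>, that is \<open>exp (\<bar>a - b\<bar> ln (1 / w)) \<le> e\<^sup>C\<close>. Smaller values
  of \<open>x\<close> are absorbed by the summand \<open>w\<close>, as \<open>b \<ge> 1\<close>.\<close>

lemma powr_change_exponent:
  fixes x K w a b C :: real
  assumes x: "0 \<le> x" "x \<le> K" and K: "1 \<le> K" and w: "0 < w" and b: "1 \<le> b" and C: "0 \<le> C"
    and w1: "w \<le> 1" and ab: "\<bar>a - b\<bar> \<le> C / ln (exp 1 + 1 / w)"
  shows "x powr b \<le> K powr C * exp C * x powr a + w"
proof (cases "x \<le> w")
  case True
  then have "x powr b \<le> x"
    using x b w1 powr_mono'[of 1 b x] by (cases "x = 0") auto
  then show ?thesis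
    using True by (intro add_increasing) auto
next
  case False
  define L where "L = ln (exp 1 + 1 / w)"
  have "exp 1 + 1 / w > 0" 
    using w by (simp add: add_pos_pos)
  then have L1: "1 \<le> L" and Lw: "- ln w \<le> L"
    using w unfolding L_def by (auto simp: ln_ge_iff exp_minus divide_simps)
  have abC: "\<bar>a - b\<bar> * L \<le> C"
    using ab L1 by (simp add: L_def[symmetric] field_simps)
  have "x powr (b - a) \<le> K powr C * exp C"
  proof (cases "1 \<le> x")
    case True
    have "\<bar>a - b\<bar> * 1 \<le> \<bar>a - b\<bar> * L"
      using L1 by (intro mult_left_mono) auto
    then have "x powr (b - a) \<le> x powr C"
      using abC True by (intro powr_mono) auto
    also have "\<dots> \<le> K powr C"
      using x C by (intro powr_mono2)
    also have "\<dots> \<le> K powr C * exp C"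
      using C by (simp add: mult_le_cancel_left1)
    finally show ?thesis .
  next
    case x1: False
    have "(b - a) * ln x \<le> \<bar>a - b\<bar> * (- ln x)"
      using x1 False w abs_ge_self[of "a - b"] mult_right_mono[of "a - b" "\<bar>a - b\<bar>" "- ln x"] by (simp add: algebra_simps)
    also have "\<dots> \<le> \<bar>a - b\<bar> * L"
    proof (intro mult_left_mono)
      have "ln w \<le> ln x"
        using False w by simp
      then show "- ln x \<le> L"
        using Lw by simp
    qed simp
    finally have "x powr (b - a) \<le> exp C"
      using False w abC by (simp add: powr_def)
    also have "\<dots> \<le> K powr C * exp C"
      using K C by (simp add: ge_one_powr_ge_zero)
    finally show ?thesis .
  qed
  then have "x powr a * x powr (b - a) \<le> x powr a * (K powr C * exp C)"
    by (intro mult_left_mono) auto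
  then show ?thesis
    using w by (simp add: powr_diff mult_ac split: if_splits)
qed

lemma ennpowr_change_exponent:
  assumes "y \<le> ennreal K" "1 \<le> K" "0 < w" "w \<le> 1" "1 \<le> b" "0 \<le> C"
    and "\<bar>a - b\<bar> \<le> C / ln (exp 1 + 1 / w)"
  shows "ennpowr y b \<le> ennreal (K powr C * exp C) * ennpowr y a + ennreal w"
proof (cases y)
  case (real x)
  then have "x powr b \<le> K powr C * exp C * x powr a + w"
    using assms by (intro powr_change_exponent) auto
  then show ?thesis
    using real assms by (simp flip: ennreal_mult ennreal_plus)
qed (use assms in \<open>simp add: top_unique\<close>)

text \<open>The bound of the lemma that follows: \<open>2 * K * (1 + N)\<close> bounds the function, and \<open>2\<close> is the
  integral of \<open>weight 1\<close>.\<close>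

definition change_const :: "real \<Rightarrow> real \<Rightarrow> real \<Rightarrow> real" where
  "change_const K C N = (2 * K * (1 + N)) powr C * exp C * N + 2"

lemma modular_change_exponent:
  assumes dom: "dyadically_dominated K f" and mod: "modular a f \<le> ennreal N"
    and a: "\<And>t. 0 < t \<Longrightarrow> 1 \<le> a t" and b: "\<And>t. 0 < t \<Longrightarrow> 1 \<le> b t"
    and ab: "\<And>t. 0 < t \<Longrightarrow> \<bar>a t - b t\<bar> \<le> C / ln (exp 1 + 1 / min t (1 / t))"
    and K: "1 \<le> K" and N: "0 \<le> N" and C: "0 \<le> C"
    and [measurable]: "f \<in> borel_measurable haar" "a \<in> borel_measurable haar"
      "b \<in> borel_measurable haar"
  shows "modular b f \<le> ennreal (change_const K C N)"
proof -
  define L where "L = (2 * K * (1 + N)) powr C * exp C"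
  have "1 * (1 * 1) \<le> 2 * (K * (1 + N))"
    using K N by (intro mult_mono) auto
  then have K1: "1 \<le> 2 * K * (1 + N)"
    by (simp add: mult.assoc)
  have "modular b f \<le> (\<integral>\<^sup>+t. ennreal L * ennpowr (f t) (a t) + ennreal (weight 1 t) \<partial>haar)"
    unfolding modular_def
  proof (intro nn_integral_mono)
    fix t assume "t \<in> space haar"
    then have t: "0 < t" by simp
    have "f t \<le> ennreal (2 * K * (1 + N))"
      using dyadically_dominated_le[OF dom mod a t _ N] K by simp
    then have "ennpowr (f t) (b t) \<le> ennreal L * ennpowr (f t) (a t) + ennreal (min t (1 / t))"
      unfolding L_def by (intro ennpowr_change_exponent K1 C ab b t min_inverse_bounds)
    then show "ennpowr (f t) (b t) \<le> ennreal L * ennpowr (f t) (a t) + ennreal (weight 1 t)"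
      using t by (simp add: weight_def)
  qed
  also have "\<dots> = ennreal L * modular a f + ennreal 2"
    by (simp add: nn_integral_add nn_integral_cmult nn_integral_weight modular_def)
  also have "\<dots> \<le> ennreal L * ennreal N + ennreal 2"
    using mod by (intro add_right_mono mult_left_mono) auto
  also have "\<dots> = ennreal (change_const K C N)"
    using N by (simp add: change_const_def L_def ennreal_mult)
  finally show ?thesis .
qed

section \<open>Hardy operators\<close>

definition kernel_op :: "(real \<Rightarrow> real \<Rightarrow> ennreal) \<Rightarrow> (real \<Rightarrow> ennreal) \<Rightarrow> real \<Rightarrow> ennreal" where
  "kernel_op k f t = (\<integral>\<^sup>+\<tau>. k t \<tau> * f \<tau> \<partial>haar)"

lemma measurable_kernel_op [measurable]:
  assumes [measurable]: "case_prod k \<in> borel_measurable (haar \<Otimes>\<^sub>M haar)" "f \<in> borel_measurable haar"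
  shows "kernel_op k f \<in> borel_measurable haar"
  unfolding kernel_op_def[abs_def] by measurable

text \<open>Jensen's inequality up to a constant: \<open>x \<le> \<beta> (1 + (x / \<beta>)\<^sup>r)\<close>, integrated, with \<open>\<beta>\<close> such that
  both summands contribute at most \<open>\<beta>\<close>. Hence the factor \<open>1 / 2\<close>.\<close>

lemma subprobability_jensen:
  assumes [measurable]: "k \<in> borel_measurable M" "f \<in> borel_measurable M"
    and k: "(\<integral>\<^sup>+x. k x \<partial>M) \<le> 1" and r: "1 \<le> r"
  shows "ennpowr ((\<integral>\<^sup>+x. k x * f x \<partial>M) / 2) r \<le> (\<integral>\<^sup>+x. k x * ennpowr (f x) r \<partial>M)"
    (is "ennpowr (?J / 2) r \<le> ?I")
proof -
  have "lesssim 1 (ennpowr (?J / 2) r) ?I"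
  proof (rule lesssimI)
    fix b :: real
    assume b: "0 < b" and I: "?I \<le> ennreal b"
    define \<beta> where "\<beta> = b powr (1 / r)"
    have \<beta>: "0 < \<beta>" "\<beta> powr r = b"
      using b r by (auto simp: \<beta>_def powr_powr)
    have pw: "f x \<le> ennreal \<beta> + ennreal (\<beta> / b) * ennpowr (f x) r" for x
    proof -
      have "f x = ennreal \<beta> * (f x / ennreal \<beta>)"
        using \<beta> by (simp add: ennreal_times_divide ennreal_cancel_left)
      also have "\<dots> \<le> ennreal \<beta> * (1 + ennpowr (f x / ennreal \<beta>) r)"
        using r by (intro mult_left_mono le_one_plus_ennpowr) auto
      also have "\<dots> = ennreal \<beta> + ennreal (\<beta> / b) * ennpowr (f x) r"
        using \<beta> b r
        by (simp add: ennpowr_divide distrib_left divide_ennreal[symmetric] ennreal_times_divide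
            ennreal_divide_times)
      finally show ?thesis .
    qed
    have "?J \<le> (\<integral>\<^sup>+x. ennreal \<beta> * k x + ennreal (\<beta> / b) * (k x * ennpowr (f x) r) \<partial>M)"
      using mult_left_mono[OF pw, of "k x" for x]
      by (intro nn_integral_mono) (simp add: distrib_left mult_ac)
    also have "\<dots> = ennreal \<beta> * (\<integral>\<^sup>+x. k x \<partial>M) + ennreal (\<beta> / b) * ?I"
      by (simp add: nn_integral_add nn_integral_cmult)
    also have "\<dots> \<le> ennreal \<beta> * 1 + ennreal (\<beta> / b) * ennreal b"
      using k I by (intro add_mono mult_left_mono) auto
    also have "\<dots> = ennreal \<beta> * 2"
      using \<beta> b by (simp flip: ennreal_mult ennreal_plus ennreal_numeral)
    finally have "?J / 2 \<le> ennreal \<beta>"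
      by (intro divide_le_posI_ennreal) (auto simp: mult.commute)
    then have "ennpowr (?J / 2) r \<le> ennpowr (ennreal \<beta>) r"
      using r by (intro ennpowr_mono) auto
    then show "ennpowr (?J / 2) r \<le> ennreal (1 * b)"
      using \<beta> by simp
  qed simp
  then show ?thesis
    by (simp add: lesssim_def)
qed

text \<open>Schur's test. Along the support of \<open>k\<close> the exponent at \<open>t\<close> may be replaced by the one at
  \<open>\<tau>\<close>, so that Jensen's inequality in each row leaves an integral in which only \<open>k\<close> depends on
  \<open>t\<close>.\<close>

lemma modular_kernel_op_le:
  assumes k[measurable]: "case_prod k \<in> borel_measurable (haar \<Otimes>\<^sub>M haar)"
    and f[measurable]: "f \<in> borel_measurable haar" and q[measurable]: "q \<in> borel_measurable haar"
    and rows: "\<And>t. 0 < t \<Longrightarrow> (\<integral>\<^sup>+\<tau>. k t \<tau> \<partial>haar) \<le> 1"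
    and cols: "\<And>\<tau>. 0 < \<tau> \<Longrightarrow> (\<integral>\<^sup>+t. k t \<tau> \<partial>haar) \<le> 1"
    and q1: "\<And>t. 0 < t \<Longrightarrow> 1 \<le> q t" and supp: "\<And>t \<tau>. k t \<tau> \<noteq> 0 \<Longrightarrow> q t = q \<tau>"
  shows "modular q (\<lambda>t. kernel_op k f t / 2) \<le> modular q f"
proof -
  have "modular q (\<lambda>t. kernel_op k f t / 2) \<le> (\<integral>\<^sup>+t. \<integral>\<^sup>+\<tau>. k t \<tau> * ennpowr (f \<tau>) (q \<tau>) \<partial>haar \<partial>haar)"
    unfolding modular_def
  proof (intro nn_integral_mono)
    fix t assume "t \<in> space haar"
    then have t: "0 < t" by simp
    have [measurable]: "k t \<in> borel_measurable haar"
      using measurable_compose_Pair1[OF _ k, of t] t by simp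
    have "ennpowr (kernel_op k f t / 2) (q t) \<le> (\<integral>\<^sup>+\<tau>. k t \<tau> * ennpowr (f \<tau>) (q t) \<partial>haar)"
      unfolding kernel_op_def using t by (intro subprobability_jensen rows q1) measurable
    also have "\<dots> = (\<integral>\<^sup>+\<tau>. k t \<tau> * ennpowr (f \<tau>) (q \<tau>) \<partial>haar)"
      using supp[of t] by (intro nn_integral_cong) (metis mult_zero_left)
    finally show "ennpowr (kernel_op k f t / 2) (q t)
        \<le> (\<integral>\<^sup>+\<tau>. k t \<tau> * ennpowr (f \<tau>) (q \<tau>) \<partial>haar)" .
  qed
  also have "\<dots> = (\<integral>\<^sup>+\<tau>. \<integral>\<^sup>+t. k t \<tau> * ennpowr (f \<tau>) (q \<tau>) \<partial>haar \<partial>haar)"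
    by (rule haar_pair.Fubini'[symmetric]) measurable
  also have "\<dots> \<le> modular q f"
    unfolding modular_def
  proof (intro nn_integral_mono)
    fix \<tau> assume "\<tau> \<in> space haar"
    then have \<tau>: "0 < \<tau>" by simp
    have [measurable]: "(\<lambda>t. k t \<tau>) \<in> borel_measurable haar"
      using measurable_Pair2[OF k, of \<tau>] \<tau> by simp
    have "(\<integral>\<^sup>+t. k t \<tau> * ennpowr (f \<tau>) (q \<tau>) \<partial>haar) = (\<integral>\<^sup>+t. k t \<tau> \<partial>haar) * ennpowr (f \<tau>) (q \<tau>)"
      by (intro nn_integral_multc) measurable
    also have "\<dots> \<le> 1 * ennpowr (f \<tau>) (q \<tau>)"
      using \<tau> by (intro mult_right_mono cols) auto
    finally show "(\<integral>\<^sup>+t. k t \<tau> * ennpowr (f \<tau>) (q \<tau>) \<partial>haar) \<le> ennpowr (f \<tau>) (q \<tau>)"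
      by simp
  qed
  finally show ?thesis .
qed

text \<open>The value at \<open>1\<close> is \<open>r\<close>, since the log-Hoelder condition at infinity is the one that controls
  \<open>p\<close> on \<open>[1, \<infinity>)\<close>.\<close>

definition glue :: "real \<Rightarrow> real \<Rightarrow> real \<Rightarrow> real" where
  "glue q r t = (if t < 1 then q else r)"

lemma measurable_glue [measurable]: "glue q r \<in> borel_measurable haar"
  unfolding glue_def[abs_def] by measurable

text \<open>Schur's test applies to the part \<open>k'\<close> of the kernel that does not cross \<open>1\<close>. The rest maps
  \<open>f\<close> to at most \<open>s * weight s t\<close> times the integral of \<open>f\<close> against \<open>weight s\<close>, which is finite
  because \<open>f \<le> 1 + f\<^sup>q\<close>.\<close>

lemma modular_kernel_op_cross:
  assumes k[measurable]: "case_prod k \<in> borel_measurable (haar \<Otimes>\<^sub>M haar)"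
    and f[measurable]: "f \<in> borel_measurable haar"
    and rows: "\<And>t. 0 < t \<Longrightarrow> (\<integral>\<^sup>+\<tau>. k t \<tau> \<partial>haar) \<le> 1"
    and cols: "\<And>\<tau>. 0 < \<tau> \<Longrightarrow> (\<integral>\<^sup>+t. k t \<tau> \<partial>haar) \<le> 1"
    and cross: "\<And>t \<tau>. 0 < t \<Longrightarrow> 0 < \<tau> \<Longrightarrow> (t < 1) \<noteq> (\<tau> < 1)
      \<Longrightarrow> k t \<tau> \<le> ennreal (s * weight s t * weight s \<tau>)"
    and q: "1 \<le> q" "1 \<le> r" and s: "0 < s" and N: "0 \<le> N"
    and mod: "modular (glue q r) f \<le> ennreal N"
  shows "modular (glue q r) (\<lambda>t. kernel_op k f t / ennreal (2 * (2 + s * N))) \<le> ennreal (N + 2 / s)"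
proof -
  define D where "D = 2 + s * N"
  have D: "2 \<le> D"
    using s N by (simp add: D_def)
  \<comment> \<open>the kernel restricted to pairs on the same side of \<open>1\<close>, where the glued exponent is constant\<close>
  define k' where "k' = (\<lambda>t \<tau>. if (t < 1) = (\<tau> < 1) then k t \<tau> else 0)"
  have [measurable]: "case_prod k' \<in> borel_measurable (haar \<Otimes>\<^sub>M haar)"
    unfolding k'_def by measurable
  have le: "k' t \<tau> \<le> k t \<tau>" for t \<tau>
    by (simp add: k'_def)
  have glue1: "1 \<le> glue q r t" for t
    using q by (simp add: glue_def)
  have cross_mass: "(\<integral>\<^sup>+\<tau>. ennreal (weight s \<tau>) * f \<tau> \<partial>haar) \<le> ennreal (2 / s + N)"
  proof -
    have "(\<integral>\<^sup>+\<tau>. ennreal (weight s \<tau>) * f \<tau> \<partial>haar)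
        \<le> (\<integral>\<^sup>+\<tau>. ennreal (weight s \<tau>) + ennpowr (f \<tau>) (glue q r \<tau>) \<partial>haar)"
    proof (intro nn_integral_mono)
      fix \<tau> assume "\<tau> \<in> space haar"
      then have w: "0 \<le> weight s \<tau>" "weight s \<tau> \<le> 1"
        using weight_bounds[of \<tau> s] s by auto
      have "ennreal (weight s \<tau>) * f \<tau>
          \<le> ennreal (weight s \<tau>) * (1 + ennpowr (f \<tau>) (glue q r \<tau>))"
        by (intro mult_left_mono le_one_plus_ennpowr glue1) auto
      also have "\<dots> \<le> ennreal (weight s \<tau>) + 1 * ennpowr (f \<tau>) (glue q r \<tau>)"
        unfolding distrib_left using w by (intro add_mono mult_right_mono) auto
      finally show "ennreal (weight s \<tau>) * f \<tau> \<le> ennreal (weight s \<tau>) + ennpowr (f \<tau>) (glue q r \<tau>)"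
        by simp
    qed
    also have "\<dots> = ennreal (2 / s) + modular (glue q r) f"
      using s by (simp add: nn_integral_add nn_integral_weight modular_def)
    also have "\<dots> \<le> ennreal (2 / s + N)"
      using s N mod by (simp add: add_left_mono)
    finally show ?thesis .
  qed
  have pw: "kernel_op k f t \<le> kernel_op k' f t + ennreal (D * weight s t)" if t: "0 < t" for t
  proof -
    have [measurable]: "k t \<in> borel_measurable haar" "k' t \<in> borel_measurable haar"
      using t measurable_compose_Pair1[of t haar "case_prod k" haar borel]
        measurable_compose_Pair1[of t haar "case_prod k'" haar borel] by auto
    have w: "0 \<le> weight s t"
      using weight_bounds[OF t, of s] s by simp
    have "kernel_op k f t
        \<le> (\<integral>\<^sup>+\<tau>. k' t \<tau> * f \<tau> + ennreal (s * weight s t) * (ennreal (weight s \<tau>) * f \<tau>) \<partial>haar)"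
      unfolding kernel_op_def
    proof (intro nn_integral_mono)
      fix \<tau> assume "\<tau> \<in> space haar"
      then have \<tau>: "0 < \<tau>" by simp
      have "k t \<tau> \<le> k' t \<tau> + ennreal (s * weight s t * weight s \<tau>)"
        using cross[OF t \<tau>] by (auto simp: k'_def)
      then have "k t \<tau> * f \<tau> \<le> (k' t \<tau> + ennreal (s * weight s t * weight s \<tau>)) * f \<tau>"
        by (intro mult_right_mono) auto
      then show "k t \<tau> * f \<tau>
          \<le> k' t \<tau> * f \<tau> + ennreal (s * weight s t) * (ennreal (weight s \<tau>) * f \<tau>)"
        using w s by (simp add: distrib_right ennreal_mult' mult.assoc)
    qed
    also have "\<dots> = kernel_op k' f t
        + ennreal (s * weight s t) * (\<integral>\<^sup>+\<tau>. ennreal (weight s \<tau>) * f \<tau> \<partial>haar)"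
      by (simp add: nn_integral_add nn_integral_cmult kernel_op_def)
    also have "\<dots> \<le> kernel_op k' f t + ennreal (s * weight s t) * ennreal (2 / s + N)"
      by (intro add_left_mono mult_left_mono cross_mass) auto
    also have "\<dots> = kernel_op k' f t + ennreal (D * weight s t)"
    proof -
      have "s * weight s t * (2 / s + N) = D * weight s t"
        using s by (simp add: D_def field_simps)
      moreover have "0 \<le> 2 / s + N" "0 \<le> s * weight s t"
        using w s N by auto
      ultimately show ?thesis
        by (metis ennreal_mult)
    qed
    finally show ?thesis .
  qed
  have "modular (glue q r) (\<lambda>t. kernel_op k f t / ennreal (2 * D))
      \<le> (\<integral>\<^sup>+t. ennpowr (kernel_op k' f t / 2) (glue q r t) + ennreal (weight s t) \<partial>haar)"
    unfolding modular_def
  proof (intro nn_integral_mono)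
    fix t assume "t \<in> space haar"
    then have t: "0 < t" by simp
    then have w: "0 \<le> weight s t" "weight s t \<le> 1"
      using weight_bounds[OF t, of s] s by auto
    let ?x = "kernel_op k' f t / 2" and ?w = "ennreal (weight s t)"
    have "kernel_op k f t \<le> ennreal D * ?x + ennreal D * ?w"
    proof -
      have "kernel_op k' f t = 2 * ?x"
        using ennreal_cancel_left[of 2] by (simp add: ennreal_times_divide)
      also have "\<dots> \<le> ennreal D * ?x"
        using D by (intro mult_right_mono) (auto simp flip: ennreal_numeral)
      finally have "kernel_op k' f t + ennreal (D * weight s t) \<le> ennreal D * ?x + ennreal D * ?w"
        using D w by (simp add: ennreal_mult add_right_mono)
      with pw[OF t] show ?thesis
        by (rule order_trans)
    qed
    also have "\<dots> \<le> ennreal D * max ?x ?w + ennreal D * max ?x ?w"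
      by (intro add_mono mult_left_mono) auto
    also have "\<dots> = ennreal (2 * D) * max ?x ?w"
      unfolding mult_2[symmetric] using D by (simp add: ennreal_mult mult.assoc)
    finally have "kernel_op k f t / ennreal (2 * D) \<le> max ?x ?w"
      using D by (intro divide_le_posI_ennreal) (auto simp: mult.commute)
    then have "ennpowr (kernel_op k f t / ennreal (2 * D)) (glue q r t)
        \<le> ennpowr (max ?x ?w) (glue q r t)"
      using glue1[of t] by (intro ennpowr_mono) auto
    also have "\<dots> \<le> ennpowr ?x (glue q r t) + ennpowr ?w (glue q r t)"
      by (auto simp: max_def)
    also have "\<dots> \<le> ennpowr ?x (glue q r t) + ?w"
      using w glue1[of t] powr_mono'[of 1 "glue q r t" "weight s t"]
      by (intro add_left_mono) (auto intro!: ennreal_leI)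
    finally show "ennpowr (kernel_op k f t / ennreal (2 * D)) (glue q r t)
        \<le> ennpowr ?x (glue q r t) + ?w" .
  qed
  also have "\<dots> = modular (glue q r) (\<lambda>t. kernel_op k' f t / 2) + ennreal (2 / s)"
    using s by (simp add: nn_integral_add nn_integral_weight modular_def)
  also have "\<dots> \<le> ennreal N + ennreal (2 / s)"
  proof (intro add_right_mono order_trans[OF modular_kernel_op_le mod])
    show "(\<integral>\<^sup>+\<tau>. k' t \<tau> \<partial>haar) \<le> 1" if "0 < t" for t
      by (rule order_trans[OF nn_integral_mono rows[OF that]]) (rule le)
    show "(\<integral>\<^sup>+t. k' t \<tau> \<partial>haar) \<le> 1" if "0 < \<tau>" for \<tau>
      by (rule order_trans[OF nn_integral_mono cols[OF that]]) (rule le)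
    show "glue q r t = glue q r \<tau>" if "k' t \<tau> \<noteq> 0" for t \<tau>
      using that by (auto simp: k'_def glue_def split: if_splits)
  qed (auto simp: glue1)
  finally show ?thesis
    using s N by (simp add: D_def)
qed

text \<open>The kernel of \<open>s \<eta>\<close>; its transpose is that of \<open>s \<lambda>\<close>. The factor \<open>s\<close> normalises the mass of
  rows and columns to \<open>1\<close>.\<close>

definition hardy_kernel :: "real \<Rightarrow> real \<Rightarrow> real \<Rightarrow> ennreal" where
  "hardy_kernel s t \<tau> = (if t < \<tau> then ennreal (s * t powr s * \<tau> powr (- s)) else 0)"

lemma measurable_hardy_kernel [measurable]:
  "(\<lambda>(t, \<tau>). hardy_kernel s t \<tau>) \<in> borel_measurable (haar \<Otimes>\<^sub>M haar)"
  "(\<lambda>(t, \<tau>). hardy_kernel s \<tau> t) \<in> borel_measurable (haar \<Otimes>\<^sub>M haar)"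
  unfolding hardy_kernel_def by measurable

lemma hardy_kernel_rows:
  assumes "0 < s" "0 < t"
  shows "(\<integral>\<^sup>+\<tau>. hardy_kernel s t \<tau> \<partial>haar) = 1"
proof -
  have [measurable]: "{t<..} \<in> sets haar"
    using assms by (simp add: Ioo_in_haar)
  have "(\<integral>\<^sup>+\<tau>. hardy_kernel s t \<tau> \<partial>haar)
      = (\<integral>\<^sup>+\<tau>. ennreal (s * t powr s) * (ennreal (\<tau> powr (- s)) * indicator {t<..} \<tau>) \<partial>haar)"
    using assms by (intro nn_integral_cong) (auto simp: hardy_kernel_def ennreal_mult')
  also have "\<dots> = ennreal (s * t powr s) * ennreal (t powr (- s) / s)"
    using assms by (simp add: nn_integral_cmult haar_powr_above)
  also have "\<dots> = 1"
    using assms by (simp add: powr_minus field_simps flip: ennreal_mult)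
  finally show ?thesis .
qed

lemma hardy_kernel_cols:
  assumes "0 < s" "0 < \<tau>"
  shows "(\<integral>\<^sup>+t. hardy_kernel s t \<tau> \<partial>haar) = 1"
proof -
  have [measurable]: "{0<..<\<tau>} \<in> sets haar"
    by (simp add: Ioo_in_haar)
  have "(\<integral>\<^sup>+t. hardy_kernel s t \<tau> \<partial>haar)
      = (\<integral>\<^sup>+t. ennreal (s * \<tau> powr (- s)) * (ennreal (t powr s) * indicator {0<..<\<tau>} t) \<partial>haar)"
    using assms by (intro nn_integral_cong) (auto simp: hardy_kernel_def mult_ac simp flip: ennreal_mult)
  also have "\<dots> = ennreal (s * \<tau> powr (- s)) * ennreal (\<tau> powr s / s)"
    using assms by (simp add: nn_integral_cmult haar_powr_below)
  also have "\<dots> = 1"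
    using assms by (simp add: powr_minus field_simps flip: ennreal_mult)
  finally show ?thesis .
qed

text \<open>If \<open>t < 1 \<le> \<tau>\<close>, then both sides agree; if \<open>\<tau> < 1 \<le> t\<close>, the kernel vanishes.\<close>

lemma hardy_kernel_cross:
  assumes "0 < t" "0 < \<tau>" "(t < 1) \<noteq> (\<tau> < 1)" "0 < s"
  shows "hardy_kernel s t \<tau> \<le> ennreal (s * weight s t * weight s \<tau>)"
  using assms by (cases "t < 1") (auto simp: hardy_kernel_def weight_eq)

lemma eta_eq_kernel_op:
  assumes s: "0 < s" and \<epsilon>: "\<epsilon> \<in> borel_measurable haar" "\<And>t. 0 < t \<Longrightarrow> 0 < \<epsilon> t" and t: "0 < t"
  shows "eta s \<epsilon> t = kernel_op (hardy_kernel s) (\<lambda>\<tau>. ennreal (\<epsilon> \<tau>)) t / ennreal s"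
proof -
  note [measurable] = \<epsilon>(1)
  have [measurable]: "{t<..} \<in> sets haar"
    using t by (simp add: Ioo_in_haar)
  let ?I = "\<integral>\<^sup>+\<tau>\<in>{t<..}. ennreal (\<tau> powr (- s) * \<epsilon> \<tau>) \<partial>haar"
  have "kernel_op (hardy_kernel s) (\<lambda>\<tau>. ennreal (\<epsilon> \<tau>)) t
      = (\<integral>\<^sup>+\<tau>. ennreal (s * t powr s) * (ennreal (\<tau> powr (- s) * \<epsilon> \<tau>) * indicator {t<..} \<tau>) \<partial>haar)"
    unfolding kernel_op_def using s \<epsilon>(2)
    by (intro nn_integral_cong)
       (auto simp: hardy_kernel_def less_imp_le mult_ac simp flip: ennreal_mult)
  also have "\<dots> = ennreal (s * t powr s) * ?I"
    by (intro nn_integral_cmult) measurable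
  also have "?I = mult_integral {t<..} (\<lambda>\<tau>. ennreal (\<tau> powr (- s) * \<epsilon> \<tau>))"
    using t by (intro mult_integral_eq_haar[symmetric]) auto
  finally show ?thesis
    using s by (simp add: eta_def ennreal_mult mult.assoc ennreal_cancel_left)
qed

lemma lam_eq_kernel_op:
  assumes s: "0 < s" and \<epsilon>: "\<epsilon> \<in> borel_measurable haar" "\<And>t. 0 < t \<Longrightarrow> 0 < \<epsilon> t" and t: "0 < t"
  shows "lam s \<epsilon> t = kernel_op (\<lambda>t \<tau>. hardy_kernel s \<tau> t) (\<lambda>\<tau>. ennreal (\<epsilon> \<tau>)) t / ennreal s"
proof -
  note [measurable] = \<epsilon>(1)
  have [measurable]: "{0<..<t} \<in> sets haar"
    by (simp add: Ioo_in_haar)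
  let ?I = "\<integral>\<^sup>+\<tau>\<in>{0<..<t}. ennreal (\<tau> powr s * \<epsilon> \<tau>) \<partial>haar"
  have "kernel_op (\<lambda>t \<tau>. hardy_kernel s \<tau> t) (\<lambda>\<tau>. ennreal (\<epsilon> \<tau>)) t
      = (\<integral>\<^sup>+\<tau>. ennreal (s * t powr (- s)) * (ennreal (\<tau> powr s * \<epsilon> \<tau>) * indicator {0<..<t} \<tau>) \<partial>haar)"
    unfolding kernel_op_def using s \<epsilon>(2)
    by (intro nn_integral_cong)
       (auto simp: hardy_kernel_def less_imp_le mult_ac simp flip: ennreal_mult)
  also have "\<dots> = ennreal (s * t powr (- s)) * ?I"
    by (intro nn_integral_cmult) measurable
  also have "?I = mult_integral {0<..<t} (\<lambda>\<tau>. ennreal (\<tau> powr s * \<epsilon> \<tau>))"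
    by (intro mult_integral_eq_haar[symmetric]) auto
  finally show ?thesis
    using s by (simp add: lam_def ennreal_mult mult.assoc ennreal_cancel_left)
qed

text \<open>\<open>t powr (- s) * \<eta>\<close> is nonincreasing, so \<open>\<eta>\<close> loses at most the factor \<open>2 powr s\<close> when passing
  from \<open>t\<close> to any point of \<open>(t / 2, t)\<close>. For \<open>\<lambda>\<close> the interval is \<open>(t, 2 t)\<close>.\<close>

lemma dyadically_dominated_eta:
  assumes s: "0 < s"
  shows "dyadically_dominated (2 powr s) (eta s \<epsilon>)"
  unfolding dyadically_dominated_def
proof (intro allI impI exI[of _ "t / 2" for t] conjI ballI)
  fix t u :: real
  assume t: "0 < t" and u: "u \<in> {t / 2<..<2 * (t / 2)}"
  let ?I = "\<lambda>t. mult_integral {t<..} (\<lambda>\<tau>. ennreal (\<tau> powr (- s) * \<epsilon> \<tau>))"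
  have "?I t \<le> ?I u"
    unfolding mult_integral_def using u by (intro nn_integral_mono) (auto simp: indicator_def)
  moreover have "t powr s \<le> (2 * u) powr s"
    using t u s by (intro powr_mono2) auto
  ultimately have "eta s \<epsilon> t \<le> ennreal ((2 * u) powr s) * ?I u"
    unfolding eta_def by (intro mult_mono ennreal_leI) auto
  also have "\<dots> = ennreal (2 powr s) * eta s \<epsilon> u"
    using t u by (simp add: eta_def powr_mult ennreal_mult mult.assoc)
  finally show "eta s \<epsilon> t \<le> ennreal (2 powr s) * eta s \<epsilon> u" .
qed simp

lemma dyadically_dominated_lam:
  assumes s: "0 < s"
  shows "dyadically_dominated (2 powr s) (lam s \<epsilon>)"
  unfolding dyadically_dominated_def
proof (intro allI impI exI[of _ "t" for t] conjI ballI)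
  fix t u :: real
  assume t: "0 < t" and u: "u \<in> {t<..<2 * t}"
  let ?I = "\<lambda>t. mult_integral {0<..<t} (\<lambda>\<tau>. ennreal (\<tau> powr s * \<epsilon> \<tau>))"
  have "?I t \<le> ?I u"
    unfolding mult_integral_def using u by (intro nn_integral_mono) (auto simp: indicator_def)
  moreover have "t powr (- s) \<le> (u / 2) powr (- s)"
    using t u s by (intro powr_mono2') auto
  ultimately have "lam s \<epsilon> t \<le> ennreal ((u / 2) powr (- s)) * ?I u"
    unfolding lam_def by (intro mult_mono ennreal_leI) auto
  also have "(u / 2) powr (- s) = 2 powr s * u powr (- s)"
    using t u by (simp add: powr_divide powr_minus field_simps)
  also have "ennreal \<dots> * ?I u = ennreal (2 powr s) * lam s \<epsilon> u"
    by (simp add: lam_def ennreal_mult mult.assoc)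
  finally show "lam s \<epsilon> t \<le> ennreal (2 powr s) * lam s \<epsilon> u" .
qed simp

section \<open>From modulars to norms\<close>

lemma luxemburg_norm_eq:
  assumes [measurable]: "f \<in> borel_measurable haar" "p \<in> borel_measurable haar"
  shows "luxemburg_norm p f
    = Inf {ennreal \<mu> | \<mu>. \<mu> > 0 \<and> modular p (\<lambda>t. f t / ennreal \<mu>) \<le> 1}"
proof -
  have "mult_integral {0<..} (\<lambda>t. ennpowr (f t / ennreal \<mu>) (p t))
      = modular p (\<lambda>t. f t / ennreal \<mu>)" for \<mu>
    unfolding modular_def
    by (subst mult_integral_eq_haar)
       (auto simp: Ioo_in_haar indicator_def intro!: nn_integral_cong)
  then show ?thesis
    by (simp add: luxemburg_norm_def)
qed

lemma luxemburg_norm_le: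
  assumes [measurable]: "f \<in> borel_measurable haar" "p \<in> borel_measurable haar"
    and p: "\<And>t. 0 < t \<Longrightarrow> 1 \<le> p t" and \<mu>: "0 < \<mu>" and N: "1 \<le> N"
    and mod: "modular p (\<lambda>t. f t / ennreal \<mu>) \<le> ennreal N"
  shows "luxemburg_norm p f \<le> ennreal (N * \<mu>)"
  unfolding luxemburg_norm_eq[OF assms(1,2)]
proof (rule Inf_lower)
  have "modular p (\<lambda>t. f t / ennreal (N * \<mu>))
      \<le> (\<integral>\<^sup>+t. ennpowr (f t / ennreal \<mu>) (p t) / ennreal N \<partial>haar)"
    unfolding modular_def
  proof (intro nn_integral_mono)
    fix t assume "t \<in> space haar"
    then show "ennpowr (f t / ennreal (N * \<mu>)) (p t) \<le> ennpowr (f t / ennreal \<mu>) (p t) / ennreal N"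
      using ennpowr_divide_le[OF N p, of t "f t / ennreal \<mu>"] \<mu> N
      by (simp add: ennreal_divide_divide mult.commute)
  qed
  also have "\<dots> = modular p (\<lambda>t. f t / ennreal \<mu>) / ennreal N"
    unfolding modular_def by (intro nn_integral_divide) measurable
  also have "\<dots> \<le> 1"
    using mod N by (intro divide_le_posI_ennreal) auto
  finally show "ennreal (N * \<mu>)
      \<in> {ennreal \<mu> | \<mu>. \<mu> > 0 \<and> modular p (\<lambda>t. f t / ennreal \<mu>) \<le> 1}"
    using \<mu> N by (auto intro!: exI[of _ "N * \<mu>"])
qed

lemma lesssim_luxemburg_normI:
  assumes [measurable]: "f \<in> borel_measurable haar" "p \<in> borel_measurable haar"
    and c: "0 < c"
    and bound: "\<And>\<mu>. 0 < \<mu> \<Longrightarrow> modular p (\<lambda>t. f t / ennreal \<mu>) \<le> 1 \<Longrightarrow> A \<le> ennreal (c * \<mu>)"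
  shows "lesssim c A (luxemburg_norm p f)"
proof -
  have "A / ennreal c \<le> luxemburg_norm p f"
    unfolding luxemburg_norm_eq[OF assms(1,2)]
  proof (rule Inf_greatest)
    fix x assume "x \<in> {ennreal \<mu> | \<mu>. \<mu> > 0 \<and> modular p (\<lambda>t. f t / ennreal \<mu>) \<le> 1}"
    then obtain \<mu> where \<mu>: "0 < \<mu>" "x = ennreal \<mu>" "modular p (\<lambda>t. f t / ennreal \<mu>) \<le> 1"
      by blast
    then show "A / ennreal c \<le> x"
      using bound[of \<mu>] c by (intro divide_le_posI_ennreal) (auto simp: ennreal_mult mult.commute)
  qed
  then have "ennreal c * (A / ennreal c) \<le> ennreal c * luxemburg_norm p f"
    by (intro mult_left_mono) auto
  then show ?thesis
    using c by (simp add: lesssim_def ennreal_times_divide ennreal_cancel_left)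
qed

text \<open>For a constant exponent, norm and modular determine each other; these are the two directions
  in the form used for each half of the split norm.\<close>

lemma
  fixes q \<mu> :: real
  assumes [measurable]: "f \<in> borel_measurable haar" and A[measurable]: "A \<in> sets haar"
    and q: "1 \<le> q" and \<mu>: "0 < \<mu>"
  defines "I \<equiv> \<integral>\<^sup>+t\<in>A. ennpowr (f t) q \<partial>haar"
    and "J \<equiv> \<integral>\<^sup>+t\<in>A. ennpowr (f t / ennreal \<mu>) q \<partial>haar"
  shows scaled_integral_le_1: "ennpowr I (1 / q) \<le> ennreal \<mu> \<Longrightarrow> J \<le> 1"
    and root_integral_le: "1 \<le> N \<Longrightarrow> J \<le> ennreal N \<Longrightarrow> ennpowr I (1 / q) \<le> ennreal (N * \<mu>)"
proof -
  have "J = (\<integral>\<^sup>+t. ennpowr (f t) q * indicator A t / ennreal (\<mu> powr q) \<partial>haar)"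
    unfolding J_def using q \<mu>
    by (intro nn_integral_cong) (auto simp: ennpowr_divide indicator_def)
  also have "\<dots> = I / ennreal (\<mu> powr q)"
    unfolding I_def by (intro nn_integral_divide) measurable
  finally have J: "J = I / ennreal (\<mu> powr q)" .
  have pos: "0 < ennreal (\<mu> powr q)"
    using \<mu> by simp
  show "J \<le> 1" if "ennpowr I (1 / q) \<le> ennreal \<mu>"
  proof -
    have "I = ennpowr (ennpowr I (1 / q)) q"
      using q by (simp add: ennpowr_ennpowr)
    also have "\<dots> \<le> ennreal (\<mu> powr q)"
      using ennpowr_mono[OF that, of q] q \<mu> by simp
    finally show ?thesis
      unfolding J using pos by (intro divide_le_posI_ennreal) auto
  qed
  show "ennpowr I (1 / q) \<le> ennreal (N * \<mu>)" if N: "1 \<le> N" and le: "J \<le> ennreal N"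
  proof -
    have "I = ennreal (\<mu> powr q) * J"
      unfolding J using \<mu> by (simp add: ennreal_times_divide ennreal_cancel_left)
    also have "\<dots> \<le> ennreal (\<mu> powr q) * ennreal (N powr q)"
      using le N q powr_mono[of 1 q N] by (intro mult_left_mono order_trans[OF le] ennreal_leI) auto
    also have "\<dots> = ennpowr (ennreal (N * \<mu>)) q"
      using N \<mu> by (simp add: powr_mult mult.commute flip: ennreal_mult)
    finally have "ennpowr I (1 / q) \<le> ennpowr (ennpowr (ennreal (N * \<mu>)) q) (1 / q)"
      using q by (intro ennpowr_mono) auto
    also have "\<dots> = ennreal (N * \<mu>)"
      using q by (subst ennpowr_ennpowr) auto
    finally show ?thesis .
  qed
qed

lemma split_norm_eq:
  assumes [measurable]: "f \<in> borel_measurable haar"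
  shows "split_norm q r f = ennpowr (\<integral>\<^sup>+t\<in>{0<..<1}. ennpowr (f t) q \<partial>haar) (1 / q)
    + ennpowr (\<integral>\<^sup>+t\<in>{1<..}. ennpowr (f t) r \<partial>haar) (1 / r)"
  unfolding split_norm_def by (subst (1 2) mult_integral_eq_haar) (auto simp: Ioo_in_haar)

lemma modular_glue:
  assumes [measurable]: "f \<in> borel_measurable haar"
  shows "modular (glue q r) f = (\<integral>\<^sup>+t\<in>{0<..<1}. ennpowr (f t) q \<partial>haar)
    + (\<integral>\<^sup>+t\<in>{1<..}. ennpowr (f t) r \<partial>haar)"
  unfolding modular_def
  by (subst nn_integral_haar_split)
     (auto intro!: arg_cong2[where f = "(+)"] nn_integral_cong simp: indicator_def glue_def)

lemma modular_le_of_split_norm_le: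
  assumes [measurable]: "f \<in> borel_measurable haar" and q: "1 \<le> q" "1 \<le> r" and \<mu>: "0 < \<mu>"
    and le: "split_norm q r f \<le> ennreal \<mu>"
  shows "modular (glue q r) (\<lambda>t. f t / ennreal \<mu>) \<le> ennreal 2"
proof -
  let ?I = "\<lambda>A q. \<integral>\<^sup>+t\<in>A. ennpowr (f t) q \<partial>haar"
  have "ennpowr (?I {0<..<1} q) (1 / q) \<le> ennreal \<mu>" "ennpowr (?I {1<..} r) (1 / r) \<le> ennreal \<mu>"
    by (rule order_trans[OF _ le[unfolded split_norm_eq[OF assms(1)]]]; simp)+
  then have "modular (glue q r) (\<lambda>t. f t / ennreal \<mu>) \<le> 1 + 1"
    using q \<mu> by (subst modular_glue, measurable)
      (intro add_mono scaled_integral_le_1; simp add: Ioo_in_haar)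
  then show ?thesis
    by simp
qed

lemma split_norm_le_of_modular_le:
  assumes [measurable]: "f \<in> borel_measurable haar" and q: "1 \<le> q" "1 \<le> r" and \<mu>: "0 < \<mu>"
    and N: "1 \<le> N" and le: "modular (glue q r) (\<lambda>t. f t / ennreal \<mu>) \<le> ennreal N"
  shows "split_norm q r f \<le> ennreal (2 * N * \<mu>)"
proof -
  let ?J = "\<lambda>A q. \<integral>\<^sup>+t\<in>A. ennpowr (f t / ennreal \<mu>) q \<partial>haar"
  have sum: "?J {0<..<1} q + ?J {1<..} r \<le> ennreal N"
    using le by (subst (asm) modular_glue) auto
  have "?J {0<..<1} q \<le> ennreal N" "?J {1<..} r \<le> ennreal N"
    by (rule order_trans[OF _ sum]; simp)+
  then have "split_norm q r f \<le> ennreal (N * \<mu>) + ennreal (N * \<mu>)"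
    unfolding split_norm_eq[OF assms(1)]
    using q \<mu> N by (intro add_mono root_integral_le) (auto simp: Ioo_in_haar)
  also have "\<dots> = ennreal (2 * N * \<mu>)"
    using N \<mu> by (simp flip: ennreal_plus)
  finally show ?thesis .
qed

lemma dyadically_dominated_divide:
  assumes "dyadically_dominated K f"
  shows "dyadically_dominated K (\<lambda>t. f t / ennreal \<mu>)"
  using assms unfolding dyadically_dominated_def divide_ennreal_def
  by (metis mult.assoc mult_right_mono zero_le)

text \<open>Both directions are \<open>modular_change_exponent\<close>, with the roles of \<open>p\<close> and of the glued exponent
  exchanged. The modular of \<open>f / \<mu>\<close> that one starts from is at most \<open>2\<close>: the split norm has
  two halves, and the Luxemburg norm provides the bound \<open>1\<close>.\<close>

lemma luxemburg_norm_approx_split_norm: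
  assumes f[measurable]: "f \<in> borel_measurable haar" and p[measurable]: "p \<in> borel_measurable haar"
    and dom: "dyadically_dominated K f" and K: "1 \<le> K"
    and p1: "\<And>t. 0 < t \<Longrightarrow> 1 \<le> p t" and q: "1 \<le> q" "1 \<le> r" and C: "0 \<le> C"
    and pq: "\<And>t. 0 < t \<Longrightarrow> \<bar>p t - glue q r t\<bar> \<le> C / ln (exp 1 + 1 / min t (1 / t))"
  shows "approx_eq (2 * change_const K C 2) (luxemburg_norm p f) (split_norm q r f)"
  unfolding approx_eq_def
proof
  let ?c = "change_const K C 2"
  have c: "1 \<le> ?c"
    using K by (simp add: change_const_def add_increasing)
  have glue1: "1 \<le> glue q r t" for t
    using q by (simp add: glue_def)
  show "lesssim (2 * ?c) (luxemburg_norm p f) (split_norm q r f)"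
  proof (rule lesssimI)
    fix \<mu> :: real
    assume \<mu>: "0 < \<mu>" and "split_norm q r f \<le> ennreal \<mu>"
    then have mod: "modular (glue q r) (\<lambda>t. f t / ennreal \<mu>) \<le> ennreal 2"
      using q by (intro modular_le_of_split_norm_le) auto
    have "modular p (\<lambda>t. f t / ennreal \<mu>) \<le> ennreal ?c"
      using pq p1 glue1 K C
      by (intro modular_change_exponent[OF dyadically_dominated_divide[OF dom] mod])
         (auto simp: abs_minus_commute)
    then have "luxemburg_norm p f \<le> ennreal (?c * \<mu>)"
      using p1 \<mu> c by (intro luxemburg_norm_le) auto
    also have "\<dots> \<le> ennreal (2 * ?c * \<mu>)"
      using c \<mu> by (intro ennreal_leI) auto
    finally show "luxemburg_norm p f \<le> ennreal (2 * ?c * \<mu>)" .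
  qed (use c in auto)
  show "lesssim (2 * ?c) (split_norm q r f) (luxemburg_norm p f)"
  proof (rule lesssim_luxemburg_normI)
    fix \<mu> :: real
    assume \<mu>: "0 < \<mu>" and "modular p (\<lambda>t. f t / ennreal \<mu>) \<le> 1"
    then have mod: "modular p (\<lambda>t. f t / ennreal \<mu>) \<le> ennreal 2"
      by (elim order_trans) simp
    have "modular (glue q r) (\<lambda>t. f t / ennreal \<mu>) \<le> ennreal ?c"
      using pq p1 glue1 K C
      by (intro modular_change_exponent[OF dyadically_dominated_divide[OF dom] mod]) auto
    then show "split_norm q r f \<le> ennreal (2 * ?c * \<mu>)"
      using q \<mu> c by (intro split_norm_le_of_modular_le) auto
  qed (use c in auto)
qed

text \<open>In \<open>split_norm_kernel_op_le\<close> the modular is at most \<open>2 + 2 / s\<close> after division by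
  \<open>2 * (2 + s * 2)\<close>; the denominator \<open>s\<close> undoes the normalisation of the kernel, and the
  leading \<open>2\<close> counts the halves of the split norm.\<close>

definition hardy_const :: "real \<Rightarrow> real" where
  "hardy_const s = 2 * (2 + 2 / s) * (2 * (2 + s * 2) / s)"

lemma hardy_const_pos: "0 < s \<Longrightarrow> 0 < hardy_const s"
  by (simp add: hardy_const_def add_pos_pos)

lemma split_norm_kernel_op_le:
  assumes k[measurable]: "case_prod k \<in> borel_measurable (haar \<Otimes>\<^sub>M haar)"
    and f[measurable]: "f \<in> borel_measurable haar"
    and rows: "\<And>t. 0 < t \<Longrightarrow> (\<integral>\<^sup>+\<tau>. k t \<tau> \<partial>haar) \<le> 1"
    and cols: "\<And>\<tau>. 0 < \<tau> \<Longrightarrow> (\<integral>\<^sup>+t. k t \<tau> \<partial>haar) \<le> 1"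
    and cross: "\<And>t \<tau>. 0 < t \<Longrightarrow> 0 < \<tau> \<Longrightarrow> (t < 1) \<noteq> (\<tau> < 1)
      \<Longrightarrow> k t \<tau> \<le> ennreal (s * weight s t * weight s \<tau>)"
    and q: "1 \<le> q" "1 \<le> r" and s: "0 < s"
    and g: "\<And>t. 0 < t \<Longrightarrow> g t = kernel_op k f t / ennreal s"
  shows "lesssim (hardy_const s) (split_norm q r g) (split_norm q r f)"
proof (rule lesssimI[OF hardy_const_pos[OF s]])
  fix \<mu> :: real
  assume \<mu>: "0 < \<mu>" and "split_norm q r f \<le> ennreal \<mu>"
  then have *: "modular (glue q r) (\<lambda>t. f t / ennreal \<mu>) \<le> ennreal 2"
    using q by (intro modular_le_of_split_norm_le) auto
  define D where "D = 2 * (2 + s * 2)"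
  have D: "0 < D"
    using s by (simp add: D_def add_pos_pos)
  have g_meas: "g \<in> borel_measurable haar"
    using g by (subst measurable_cong[where g = "\<lambda>t. kernel_op k f t / ennreal s"]) auto
  have "g t / ennreal (D / s * \<mu>) = kernel_op k (\<lambda>t. f t / ennreal \<mu>) t / ennreal D" if t: "0 < t" for t
  proof -
    have [measurable]: "k t \<in> borel_measurable haar"
      using measurable_Pair1[OF k, of t] t by simp
    have "kernel_op k (\<lambda>t. f t / ennreal \<mu>) t = kernel_op k f t / ennreal \<mu>"
      unfolding kernel_op_def ennreal_times_divide by (intro nn_integral_divide) measurable
    then show ?thesis
      using t s \<mu> D by (simp add: g ennreal_divide_divide mult.commute)
  qed
  then have "modular (glue q r) (\<lambda>t. g t / ennreal (D / s * \<mu>))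
      = modular (glue q r) (\<lambda>t. kernel_op k (\<lambda>t. f t / ennreal \<mu>) t / ennreal D)"
    unfolding modular_def by (intro nn_integral_cong) auto
  also have "\<dots> \<le> ennreal (2 + 2 / s)"
    unfolding D_def using rows cols cross q s * by (intro modular_kernel_op_cross) auto
  finally have "split_norm q r g \<le> ennreal (2 * (2 + 2 / s) * (D / s * \<mu>))"
    using g_meas q s D \<mu> by (intro split_norm_le_of_modular_le) auto
  then show "split_norm q r g \<le> ennreal (hardy_const s * \<mu>)"
    by (simp add: hardy_const_def D_def mult.assoc)
qed

text \<open>\<open>p_inf\<close> is the limit of \<open>p\<close> at infinity. If it were below \<open>1\<close> by \<open>\<delta>\<close>, then \<open>p\<close> would be
  below \<open>1\<close> as soon as \<open>ln (e + x) > c / \<delta>\<close>.\<close>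

lemma one_le_limit_exponent:
  assumes "log_holder_infinity c p_inf p" "\<And>x. 1 \<le> p x"
  shows "1 \<le> p_inf"
proof (rule ccontr)
  assume "\<not> 1 \<le> p_inf"
  define \<delta> where "\<delta> = 1 - p_inf"
  define x where "x = exp (c / \<delta>)"
  have \<delta>: "0 < \<delta>" and c: "0 < c"
    using \<open>\<not> 1 \<le> p_inf\<close> assms(1) by (auto simp: \<delta>_def log_holder_infinity_def)
  have "c / \<delta> = ln x"
    by (simp add: x_def)
  also have "\<dots> < ln (exp 1 + \<bar>x\<bar>)"
    by (subst ln_less_cancel_iff) (auto simp: x_def add_pos_pos)
  finally have L: "c / \<delta> < ln (exp 1 + \<bar>x\<bar>)" .
  have "0 < c / \<delta>"
    using \<delta> c by simp
  then have "0 < ln (exp 1 + \<bar>x\<bar>)"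
    using L by (rule less_trans)
  with L have "c / ln (exp 1 + \<bar>x\<bar>) < \<delta>"
    using \<delta> by (simp add: pos_divide_less_eq mult.commute)
  then have "\<bar>p x - p_inf\<bar> < \<delta>"
    using assms(1) unfolding log_holder_infinity_def by (meson le_less_trans)
  then show False
    using assms(2)[of x] by (simp add: \<delta>_def)
qed

text \<open>On each side of \<open>1\<close> one of the two conditions applies, since \<open>1 / min t (1 / t)\<close> is
  \<open>1 / t\<close> below \<open>1\<close> and \<open>t\<close> above.\<close>

lemma log_holder_glue:
  assumes "log_holder_origin c p" "log_holder_infinity d p_inf p" and t: "0 < t"
  shows "\<bar>p t - glue (p 0) p_inf t\<bar> \<le> max c d / ln (exp 1 + 1 / min t (1 / t))"
proof -
  have pos: "0 \<le> ln (exp 1 + x)" if "0 \<le> x" for x :: real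
    using that exp_ge_add_one_self[of 1] by (intro ln_ge_zero) simp
  show ?thesis
  proof (cases "t < 1")
    case True
    have "\<bar>p t - p 0\<bar> \<le> c / ln (exp 1 + 1 / t)"
      using assms(1) t by (auto simp: log_holder_origin_def dest: spec[of _ t])
    also have "\<dots> \<le> max c d / ln (exp 1 + 1 / t)"
      using t by (intro divide_right_mono pos) auto
    finally show ?thesis
      using True t by (simp add: glue_def min_inverse_eq)
  next
    case False
    have "\<bar>p t - p_inf\<bar> \<le> d / ln (exp 1 + t)"
      using assms(2) t by (auto simp: log_holder_infinity_def dest: spec[of _ t])
    also have "\<dots> \<le> max c d / ln (exp 1 + t)"
      using t by (intro divide_right_mono pos) auto
    finally show ?thesis
      using False t by (simp add: glue_def min_inverse_eq)
  qed
qed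

theorem theorem1:
  fixes s p_minus p_plus c_log c_log_inf :: real
  assumes "s > 0" and "1 \<le> p_minus" and "p_minus \<le> p_plus"
  shows "\<exists>c>0. \<forall>(p :: real \<Rightarrow> real) (p_inf :: real) (\<epsilon> :: real \<Rightarrow> real).
      p \<in> borel_measurable lebesgue \<longrightarrow>
      (\<forall>x. 1 \<le> p x) \<longrightarrow>
      ess_inf lebesgue (\<lambda>x. ereal (p x)) = ereal p_minus \<longrightarrow>
      esssup lebesgue (\<lambda>x. ereal (p x)) = ereal p_plus \<longrightarrow>
      log_holder_origin c_log p \<longrightarrow>
      log_holder_infinity c_log_inf p_inf p \<longrightarrow>
      \<epsilon> \<in> borel_measurable (lebesgue_on {0<..}) \<longrightarrow>
      (\<forall>t>0. \<epsilon> t > 0) \<longrightarrow>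
      approx_eq c (luxemburg_norm p (eta s \<epsilon>)) (split_norm (p 0) p_inf (eta s \<epsilon>)) \<and>
      approx_eq c (luxemburg_norm p (lam s \<epsilon>)) (split_norm (p 0) p_inf (lam s \<epsilon>)) \<and>
      lesssim c (luxemburg_norm p (eta s \<epsilon>) + luxemburg_norm p (lam s \<epsilon>))
        (split_norm (p 0) p_inf (\<lambda>t. ennreal (\<epsilon> t)))"
proof -
  define C where "C = max c_log c_log_inf"
  \<comment> \<open>\<open>c1\<close> serves the two equivalences; the last estimate combines each with Hardy's inequality\<close>
  define c1 where "c1 = 2 * change_const (2 powr s) C 2"
  define c where "c = c1 + 2 * (c1 * hardy_const s)"
  have c1: "0 < c1"
    by (simp add: c1_def change_const_def add_nonneg_pos)
  have h: "0 < hardy_const s"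
    using assms(1) by (rule hardy_const_pos)
  have c: "0 < c" "c1 \<le> c" "2 * (c1 * hardy_const s) \<le> c"
    using c1 h by (auto simp: c_def add_pos_pos)
  have K: "1 \<le> 2 powr s"
    using assms(1) by (simp add: ge_one_powr_ge_zero)
  show ?thesis
  proof (intro exI[of _ c] conjI allI impI c(1))
    fix p :: "real \<Rightarrow> real" and p_inf :: real and \<epsilon> :: "real \<Rightarrow> real"
    assume p: "p \<in> borel_measurable lebesgue" and p1: "\<forall>x. 1 \<le> p x"
      and origin: "log_holder_origin c_log p" and infinity: "log_holder_infinity c_log_inf p_inf p"
      and eps: "\<epsilon> \<in> borel_measurable (lebesgue_on {0<..})" and eps_pos: "\<forall>t>0. 0 < \<epsilon> t"
    let ?N = "split_norm (p 0) p_inf"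
    have [measurable]: "p \<in> borel_measurable haar" "\<epsilon> \<in> borel_measurable haar"
      using p eps by (auto simp: haar_def intro: measurable_restrict_space1)
    have exps: "1 \<le> p 0" "1 \<le> p_inf"
      using p1 one_le_limit_exponent[OF infinity] by auto
    have C: "0 \<le> C"
      using origin by (simp add: C_def log_holder_origin_def max.coboundedI1)
    have pC: "\<bar>p t - glue (p 0) p_inf t\<bar> \<le> C / ln (exp 1 + 1 / min t (1 / t))" if "0 < t" for t
      unfolding C_def using log_holder_glue[OF origin infinity that] .
    note eta = eta_eq_kernel_op[of s \<epsilon>] and lam = lam_eq_kernel_op[of s \<epsilon>]
    have [measurable]: "eta s \<epsilon> \<in> borel_measurable haar"
      by (subst measurable_cong[OF eta]) (use assms(1) eps_pos in auto)
    have [measurable]: "lam s \<epsilon> \<in> borel_measurable haar"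
      by (subst measurable_cong[OF lam]) (use assms(1) eps_pos in auto)
    have approx: "approx_eq c1 (luxemburg_norm p f) (?N f)"
      if "dyadically_dominated (2 powr s) f" "f \<in> borel_measurable haar" for f :: "real \<Rightarrow> ennreal"
      unfolding c1_def using p1
      by (intro luxemburg_norm_approx_split_norm that K exps C pC) auto
    have approx_eta: "approx_eq c1 (luxemburg_norm p (eta s \<epsilon>)) (?N (eta s \<epsilon>))"
      and approx_lam: "approx_eq c1 (luxemburg_norm p (lam s \<epsilon>)) (?N (lam s \<epsilon>))"
      using assms(1) by (auto intro!: approx dyadically_dominated_eta dyadically_dominated_lam)
    then show "approx_eq c (luxemburg_norm p (eta s \<epsilon>)) (?N (eta s \<epsilon>))"
      and "approx_eq c (luxemburg_norm p (lam s \<epsilon>)) (?N (lam s \<epsilon>))"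
      using c(2) by (auto simp: approx_eq_def intro: lesssim_mono)
    have hardy_eta: "lesssim (hardy_const s) (?N (eta s \<epsilon>)) (?N (\<lambda>t. ennreal (\<epsilon> t)))"
      using assms(1) eps_pos
      by (intro split_norm_kernel_op_le[where k = "hardy_kernel s"] exps eta hardy_kernel_cross)
         (auto simp: hardy_kernel_rows hardy_kernel_cols)
    have hardy_lam: "lesssim (hardy_const s) (?N (lam s \<epsilon>)) (?N (\<lambda>t. ennreal (\<epsilon> t)))"
    proof (intro split_norm_kernel_op_le[where k = "\<lambda>t \<tau>. hardy_kernel s \<tau> t"] exps lam)
      show "hardy_kernel s \<tau> t \<le> ennreal (s * weight s t * weight s \<tau>)"
        if "0 < t" "0 < \<tau>" "(t < 1) \<noteq> (\<tau> < 1)" for t \<tau>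
        using hardy_kernel_cross[of \<tau> t s] that assms(1) by (simp add: mult.assoc mult.left_commute mult.commute)
    qed (use assms(1) eps_pos in \<open>auto simp: hardy_kernel_rows hardy_kernel_cols\<close>)
    have "lesssim (2 * (c1 * hardy_const s))
        (luxemburg_norm p (eta s \<epsilon>) + luxemburg_norm p (lam s \<epsilon>)) (?N (\<lambda>t. ennreal (\<epsilon> t)))"
    proof (rule lesssim_add)
      show "lesssim (c1 * hardy_const s) (luxemburg_norm p (eta s \<epsilon>)) (?N (\<lambda>t. ennreal (\<epsilon> t)))"
        using approx_eta unfolding approx_eq_def by (blast intro: lesssim_trans[OF _ hardy_eta c1 h])
      show "lesssim (c1 * hardy_const s) (luxemburg_norm p (lam s \<epsilon>)) (?N (\<lambda>t. ennreal (\<epsilon> t)))"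
        using approx_lam unfolding approx_eq_def by (blast intro: lesssim_trans[OF _ hardy_lam c1 h])
    qed (use c1 h in simp)
    then show "lesssim c (luxemburg_norm p (eta s \<epsilon>) + luxemburg_norm p (lam s \<epsilon>))
        (?N (\<lambda>t. ennreal (\<epsilon> t)))"
      using c(3) by (rule lesssim_mono)
  qed
qed

end
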